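(* Let $0\le M\le n$ be integers and let $\lambda_0\ge\lambda_1\ge\dots\ge\lambda_M\ge 0>\lambda_{M+1}\ge\dots\ge\lambda_n$ be real numbers. Suppose there exists a partition $\Lambda_1\cup\Lambda_2\cup\dots\cup\Lambda_S$ of the list $\{\lambda_{M+1},\lambda_{M+2},\dots,\lambda_n\}$ such that $|\Lambda_j|$ is odd for $j=1,2,\dots,\min\{M,S\}$ and such that, with $T_k=\sum_{\lambda_i\in\Lambda_k}\lambda_i$, one has $T_S\ge T_{S-1}\ge\dots\ge T_1$ and (1) $\displaystyle \lambda_0+\sum_{i\in K,\ i<k}(\lambda_i+T_i)+T_k\ge 0$ for all $k\in K$, and (2) $\displaystyle \lambda_0+\sum_{i\in K}(\lambda_i+T_i)+\sum_{j=M+1}^{S}T_j\ge 0$, where $K=\{i\in\{1,2,\dots,\min\{M,S\}\} : \lambda_i+T_i<0\}$. Then there is an $(n+1)\times(n+1)$ nonnegative bisymmetric matrix with eigenvalues (counted with multiplicity) $\lambda_0,\lambda_1,\dots,\lambda_n$.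
   Context: All matrices are real. A square matrix $Q$ is bisymmetric if $Q^T=Q$ and $JQJ=Q$, where $J$ is the reverse identity matrix (ones on the anti-diagonal, zeros elsewhere). A matrix is nonnegative if all its entries are $\ge 0$. Lists of numbers are multisets: a partition of a list is obtained from a partition of its index set into nonempty blocks, and $|\Lambda_j|$ is the number of entries of $\Lambda_j$ counted with multiplicity. Empty sums are $0$ (in particular the last sum in (2) is $0$ if $S\le M$). *)

theory Defs
  imports
    "Jordan_Normal_Form.Char_Poly"
    "HOL-Library.Disjoint_Sets"
    Complex_Main
begin

definition nonneg_matrix :: "real mat \<Rightarrow> bool" where
  "nonneg_matrix A \<longleftrightarrow> (\<forall>i < dim_row A. \<forall>j < dim_col A. A $$ (i, j) \<ge> 0)"

definition reverse_id_mat :: "nat \<Rightarrow> real mat" where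
  "reverse_id_mat m = mat m m (\<lambda>(i, j). if i + j + 1 = m then 1 else 0)"

definition bisymmetric :: "real mat \<Rightarrow> bool" where
  "bisymmetric Q \<longleftrightarrow> square_mat Q \<and> transpose_mat Q = Q \<and>
     reverse_id_mat (dim_row Q) * Q * reverse_id_mat (dim_row Q) = Q"

(* Partitions are taken on index sets, so that repeated values in the list stay distinct entries.
   The blocks are numbered 1, ..., S; injectivity together with partition_on makes distinctly
   numbered blocks disjoint. *)
definition indexed_partition :: "nat set \<Rightarrow> nat \<Rightarrow> (nat \<Rightarrow> nat set) \<Rightarrow> bool" where
  "indexed_partition A S \<Lambda> \<longleftrightarrow> inj_on \<Lambda> {1..S} \<and> partition_on A (\<Lambda> ` {1..S})"

definition block_sum :: "(nat \<Rightarrow> real) \<Rightarrow> (nat \<Rightarrow> nat set) \<Rightarrow> nat \<Rightarrow> real" where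
  "block_sum lam \<Lambda> k = (\<Sum>i\<in>\<Lambda> k. lam i)"

definition deficit_indices ::
    "(nat \<Rightarrow> real) \<Rightarrow> (nat \<Rightarrow> real) \<Rightarrow> nat \<Rightarrow> nat \<Rightarrow> nat set" where
  "deficit_indices lam T M S = {i \<in> {1..min M S}. lam i + T i < 0}"

end

theory Submission
  imports Defs
begin

text \<open>
  A bisymmetric matrix \<open>B\<close> of even size can be cut in the middle and wrapped around a bisymmetric
  matrix \<open>A\<close>. Given unit eigenvectors \<open>u\<close> of \<open>A\<close> and \<open>v\<close> of \<open>B\<close> that are nonnegative and fixed by
  the reversal \<open>J\<close>, with eigenvalues \<open>\<alpha>\<close> and \<open>\<beta>\<close>, the coupling blocks \<open>\<rho> u v\<^sup>T\<close> and \<open>\<rho> v u\<^sup>T\<close> keep the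
  matrix nonnegative and bisymmetric, keep all other eigenvalues, and replace \<open>\<alpha>, \<beta>\<close> by the
  eigenvalues \<open>\<mu>, \<nu>\<close> of the \<open>2 \<times> 2\<close> matrix with rows \<open>(\<alpha>, \<rho>)\<close> and \<open>(\<rho>, \<beta>)\<close> (Fiedler's lemma).
  The eigenvector for \<open>\<mu>\<close> is again nonnegative and fixed by \<open>J\<close>, so the step can be iterated.

  Since \<open>\<Lambda>\<^sub>k\<close> has odd size for \<open>k \<le> min M S\<close>, the list \<open>max \<lambda>\<^sub>k (- T\<^sub>k)\<close>, \<open>\<Lambda>\<^sub>k\<close> is realised by a matrix of
  even size. Wrapping it around the part built so far turns \<open>max \<lambda>\<^sub>k (- T\<^sub>k)\<close> into \<open>\<lambda>\<^sub>k\<close> and raises the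
  distinguished eigenvalue by \<open>- min 0 (\<lambda>\<^sub>k + T\<^sub>k)\<close>; condition (1) is what makes \<open>\<rho>\<close> real. The
  innermost part has distinguished eigenvalue \<open>\<lambda>\<^sub>0 + (\<Sum>i\<in>K. \<lambda>\<^sub>i + T\<^sub>i)\<close>. It carries the surplus blocks
  if \<open>S > M\<close>, by (2), and otherwise the surplus nonnegative numbers, which by (1) and
  monotonicity do not exceed its distinguished eigenvalue.
\<close>

section \<open>Inserting one vector into the middle of another\<close>

definition nest :: "nat \<Rightarrow> nat \<Rightarrow> (nat \<Rightarrow> 'a) \<Rightarrow> (nat \<Rightarrow> 'a) \<Rightarrow> nat \<Rightarrow> 'a" where
  "nest N p z y i = (if i < p then y i else if i < p + N then z (i - p) else y (i - N))"

text \<open>The inner vector is centred, so reversal of all positions restricts to the reversal of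
  each piece. The equations hold for all \<open>z\<close> and \<open>y\<close>, so one case split
  serves rows, columns and eigenvectors.\<close>

lemma nest_cases [consumes 1]:
  assumes "i < N + 2 * p"
  obtains (inner) j where "j < N" "\<And>z y :: nat \<Rightarrow> real. nest N p z y i = z j"
            "\<And>z y :: nat \<Rightarrow> real. nest N p z y (N + 2 * p - 1 - i) = z (N - 1 - j)"
  | (outer) j where "j < 2 * p" "\<And>z y :: nat \<Rightarrow> real. nest N p z y i = y j"
            "\<And>z y :: nat \<Rightarrow> real. nest N p z y (N + 2 * p - 1 - i) = y (2 * p - 1 - j)"
proof -
  consider "i < p" | "p \<le> i" "i < p + N" | "p + N \<le> i" by linarith
  then show thesis
  proof cases
    case 1
    then show ?thesis by (intro outer[of i]) (auto simp: nest_def)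
  next
    case 2
    moreover have "N + 2 * p - 1 - i - p = N - 1 - (i - p)" using 2 by linarith
    ultimately show ?thesis
      by (intro inner[of "i - p"]) (auto simp: nest_def)
  next
    case 3
    then have "N + 2 * p - 1 - i = 2 * p - 1 - (i - N)" using assms by linarith
    with 3 assms show ?thesis by (intro outer[of "i - N"]) (auto simp: nest_def)
  qed
qed

lemma sum_nest:
  fixes z y :: "nat \<Rightarrow> 'a::comm_monoid_add"
  shows "(\<Sum>i<N + 2 * p. nest N p z y i) = (\<Sum>i<N. z i) + (\<Sum>i<2 * p. y i)"
proof -
  have split: "(\<Sum>i<m + k. f i) = (\<Sum>i<m. f i) + (\<Sum>i<k. f (m + i))"
    for m k and f :: "nat \<Rightarrow> 'a"
    by (induction k) (auto simp: add.assoc)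
  have "(\<Sum>i<N + 2 * p. nest N p z y i) = (\<Sum>i<p + (N + p). nest N p z y i)"
    by (simp add: mult_2 add_ac)
  also have "\<dots> = (\<Sum>i<p. y i) + ((\<Sum>i<N. z i) + (\<Sum>i<p. y (p + i)))"
    unfolding split by (intro arg_cong2[of _ _ _ _ plus] sum.cong) (auto simp: nest_def add_ac)
  also have "\<dots> = (\<Sum>i<N. z i) + (\<Sum>i<p + p. y i)"
    unfolding split by (simp add: add_ac)
  finally show ?thesis by (simp add: mult_2)
qed

lemma sum_nest_mult:
  fixes z y z' y' :: "nat \<Rightarrow> 'a::comm_semiring_0"
  shows "(\<Sum>i<N + 2 * p. nest N p z y i * nest N p z' y' i)
    = (\<Sum>i<N. z i * z' i) + (\<Sum>i<2 * p. y i * y' i)"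
proof -
  have "nest N p z y i * nest N p z' y' i = nest N p (\<lambda>i. z i * z' i) (\<lambda>i. y i * y' i) i" for i
    by (simp add: nest_def)
  then show ?thesis by (simp add: sum_nest)
qed

section \<open>Bisymmetric matrices as functions, with their eigenvectors\<close>

definition bisym_fun :: "nat \<Rightarrow> (nat \<Rightarrow> nat \<Rightarrow> real) \<Rightarrow> bool" where
  "bisym_fun N A \<longleftrightarrow> (\<forall>i<N. \<forall>j<N. A i j \<ge> 0 \<and> A j i = A i j \<and> A (N - 1 - i) (N - 1 - j) = A i j)"

text \<open>Carrying a full orthonormal family records multiplicities and later gives the
  characteristic polynomial by orthogonal diagonalisation.\<close>

definition eigenbasis ::
    "nat \<Rightarrow> (nat \<Rightarrow> nat \<Rightarrow> real) \<Rightarrow> (nat \<Rightarrow> real) \<Rightarrow> (nat \<Rightarrow> nat \<Rightarrow> real) \<Rightarrow> bool" where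
  "eigenbasis N A e w \<longleftrightarrow>
     (\<forall>k<N. \<forall>l<N. (\<Sum>i<N. w k i * w l i) = of_bool (k = l)) \<and>
     (\<forall>k<N. \<forall>i<N. (\<Sum>j<N. A i j * w k j) = e k * w k i)"

text \<open>
  The eigenvalue \<open>\<mu>\<close> is distinguished only by its eigenvector being nonnegative and reversal
  invariant; it need not be the spectral radius, and \<open>X\<close> lists the remaining eigenvalues.
\<close>
definition realisable :: "real \<Rightarrow> real multiset \<Rightarrow> bool" where
  "realisable \<mu> X \<longleftrightarrow> (\<exists>A e w. let N = Suc (size X) in
     bisym_fun N A \<and> eigenbasis N A e w \<and>
     (\<forall>i<N. w 0 i \<ge> 0 \<and> w 0 (N - 1 - i) = w 0 i) \<and>
     e 0 = \<mu> \<and> mset (map e [1..<N]) = X)"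

lemma realisable_empty:
  assumes "\<mu> \<ge> 0"
  shows "realisable \<mu> {#}"
  unfolding realisable_def Let_def
  by (rule exI[of _ "\<lambda>_ _. \<mu>"], rule exI[of _ "\<lambda>_. \<mu>"], rule exI[of _ "\<lambda>_ _. 1"])
    (use assms in \<open>auto simp: bisym_fun_def eigenbasis_def\<close>)

text \<open>The matrix with diagonal \<open>(\<mu> + x) / 2\<close> and off-diagonal
  \<open>(\<mu> - x) / 2\<close> has eigenvectors (1, 1) and (1, -1); the bound on \<open>x\<close>
  makes its entries nonnegative.\<close>

lemma realisable_single:
  assumes "\<bar>x\<bar> \<le> \<mu>"
  shows "realisable \<mu> {#x#}"
proof -
  define A :: "nat \<Rightarrow> nat \<Rightarrow> real" where "A i j = (if i = j then \<mu> + x else \<mu> - x) / 2" for i j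
  define e where "e k = (if k = 0 then \<mu> else x)" for k :: nat
  define w :: "nat \<Rightarrow> nat \<Rightarrow> real" where "w k i = (if k = 1 \<and> i = 1 then - 1 else 1) / sqrt 2" for k i
  have "bisym_fun 2 A"
    using assms by (auto simp: bisym_fun_def A_def less_2_cases_iff)
  moreover have "eigenbasis 2 A e w"
    by (auto simp: eigenbasis_def A_def e_def w_def less_2_cases_iff numeral_2_eq_2 field_simps)
  moreover have "\<forall>i<2. w 0 i \<ge> 0 \<and> w 0 (2 - 1 - i) = w 0 i"
    by (simp add: w_def)
  ultimately show ?thesis
    unfolding realisable_def Let_def
    by (intro exI[of _ A] exI[of _ e] exI[of _ w]) (simp add: e_def numeral_2_eq_2)
qed

text \<open>
  The weights \<open>a, b\<close> are the coordinates, in the basis \<open>u, v\<close>, of the eigenvector for \<open>\<mu>\<close>. The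
  coupling constant is then \<open>\<rho> = (\<mu> - \<nu>) a b\<close>.
\<close>
lemma realisable_nest:
  assumes X: "realisable (a\<^sup>2 * \<mu> + b\<^sup>2 * \<nu>) X"
    and Y: "realisable (b\<^sup>2 * \<mu> + a\<^sup>2 * \<nu>) Y" "odd (size Y)"
    and ab: "a \<ge> 0" "b \<ge> 0" "a\<^sup>2 + b\<^sup>2 = 1" "(\<mu> - \<nu>) * a * b \<ge> 0"
  shows "realisable \<mu> (add_mset \<nu> (X + Y))"
proof -
  define N where "N = Suc (size X)"
  obtain p where p: "Suc (size Y) = 2 * p" "0 < p"
    using Y(2) by (metis evenE even_Suc nat_0_less_mult_iff zero_less_Suc)
  obtain A e w where A: "bisym_fun N A" "eigenbasis N A e w"
    "\<And>i. i < N \<Longrightarrow> w 0 i \<ge> 0" "\<And>i. i < N \<Longrightarrow> w 0 (N - 1 - i) = w 0 i"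
    "e 0 = a\<^sup>2 * \<mu> + b\<^sup>2 * \<nu>" "mset (map e [1..<N]) = X"
    using X unfolding realisable_def Let_def N_def[symmetric] by blast
  obtain B f x where B: "bisym_fun (2 * p) B" "eigenbasis (2 * p) B f x"
    "\<And>i. i < 2 * p \<Longrightarrow> x 0 i \<ge> 0" "\<And>i. i < 2 * p \<Longrightarrow> x 0 (2 * p - 1 - i) = x 0 i"
    "f 0 = b\<^sup>2 * \<mu> + a\<^sup>2 * \<nu>" "mset (map f [1..<2 * p]) = Y"
    using Y(1) unfolding realisable_def Let_def p(1) by blast
  define \<rho> where "\<rho> = (\<mu> - \<nu>) * a * b"
  define C where "C i j = nest N p
      (\<lambda>i'. nest N p (\<lambda>j'. A i' j') (\<lambda>j'. \<rho> * w 0 i' * x 0 j') j)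
      (\<lambda>i'. nest N p (\<lambda>j'. \<rho> * x 0 i' * w 0 j') (\<lambda>j'. B i' j') j) i" for i j
  \<comment> \<open>The eigenvector \<open>h k\<close> has inner part \<open>c k * w (s k)\<close>
    and outer part \<open>d k * x (t k)\<close>: first (a u, b v), then the other vectors of
    \<open>w\<close> padded by 0, at \<open>k = N\<close> the vector (-b u, a v), then the other
    vectors of \<open>x\<close>. Where \<open>s\<close> or truncated subtraction in \<open>t\<close>
    yields 0, the coefficient either vanishes or calls for u or v.\<close>
  define c where "c k = (if k = 0 then a else if k < N then 1 else if k = N then - b else 0)" for k
  define d where "d k = (if k = 0 then b else if k < N then 0 else if k = N then a else 1)" for k
  define s where "s k = (if k < N then k else 0)" for k
  define t where "t k = k - N" for k
  define h where "h k = nest N p (\<lambda>i. c k * w (s k) i) (\<lambda>i. d k * x (t k) i)" for k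
  define g where "g k = (if k = 0 then \<mu> else if k < N then e k else if k = N then \<nu> else f (k - N))" for k
  have reflect: "i < N \<Longrightarrow> w 0 (N - Suc i) = w 0 i" "j < 2 * p \<Longrightarrow> x 0 (2 * p - Suc j) = x 0 j" for i j
    using A(4)[of i] B(4)[of j] by simp_all
  have N0: "0 < N" by (simp add: N_def)
  have st: "s k < N" "t k < 2 * p" if "k < N + 2 * p" for k
    using that p N0 by (auto simp: s_def t_def)
  have ww: "(\<Sum>i<N. w k i * w l i) = of_bool (k = l)" if "k < N" "l < N" for k l
    using A(2) that by (auto simp: eigenbasis_def)
  have xx: "(\<Sum>i<2 * p. x k i * x l i) = of_bool (k = l)" if "k < 2 * p" "l < 2 * p" for k l
    using B(2) that by (auto simp: eigenbasis_def)
  have Aw: "(\<Sum>j<N. A i j * w k j) = e k * w k i" if "k < N" "i < N" for k i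
    using A(2) that by (auto simp: eigenbasis_def)
  have Bx: "(\<Sum>j<2 * p. B i j * x k j) = f k * x k i" if "k < 2 * p" "i < 2 * p" for k i
    using B(2) that by (auto simp: eigenbasis_def)
  have "bisym_fun (N + 2 * p) C"
    unfolding bisym_fun_def
  proof (intro allI impI)
    fix i j assume i: "i < N + 2 * p" and j: "j < N + 2 * p"
    have \<rho>: "\<rho> \<ge> 0" using ab by (simp add: \<rho>_def)
    note [simp] = \<rho> A(3) B(3) reflect
    show "C i j \<ge> 0 \<and> C j i = C i j \<and> C (N + 2 * p - 1 - i) (N + 2 * p - 1 - j) = C i j"
      using i
    proof (cases rule: nest_cases)
      case (inner i')
      note i' = inner
      show ?thesis using j
      proof (cases rule: nest_cases)
        case (inner j')
        then show ?thesis unfolding C_def i'(2-) inner(2-)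
          using i'(1) A(1) by (auto simp: bisym_fun_def)
      next
        case (outer j')
        then show ?thesis unfolding C_def i'(2-) outer(2-)
          using i'(1) by simp
      qed
    next
      case (outer i')
      note i' = outer
      show ?thesis using j
      proof (cases rule: nest_cases)
        case (inner j')
        then show ?thesis unfolding C_def i'(2-) inner(2-)
          using i'(1) by simp
      next
        case (outer j')
        then show ?thesis unfolding C_def i'(2-) outer(2-)
          using i'(1) B(1) by (auto simp: bisym_fun_def)
      qed
    qed
  qed
  moreover have "eigenbasis (N + 2 * p) C g h"
    unfolding eigenbasis_def
  proof (intro conjI allI impI)
    fix k l assume kl: "k < N + 2 * p" "l < N + 2 * p"
    have "(\<Sum>i<N + 2 * p. h k i * h l i)
      = c k * c l * (\<Sum>i<N. w (s k) i * w (s l) i) + d k * d l * (\<Sum>i<2 * p. x (t k) i * x (t l) i)"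
      unfolding h_def sum_nest_mult by (simp add: sum_distrib_left mult_ac)
    also have "\<dots> = c k * c l * of_bool (s k = s l) + d k * d l * of_bool (t k = t l)"
      using kl by (simp add: ww xx st)
    also have "\<dots> = of_bool (k = l)"
      using ab(3) N0 by (auto simp: c_def d_def s_def t_def power2_eq_square add_ac)
    finally show "(\<Sum>i<N + 2 * p. h k i * h l i) = of_bool (k = l)" .
  next
    fix k i assume k: "k < N + 2 * p" and i: "i < N + 2 * p"
    \<comment> \<open>These say that (a, b) and (-b, a) are eigenvectors of the coupled 2 x 2
      matrix. The factor \<open>a\<^sup>2 + b\<^sup>2\<close> is kept so that they are polynomial
      identities.\<close>
    have "(a\<^sup>2 * \<mu> + b\<^sup>2 * \<nu>) * a + \<rho> * b = \<mu> * a * (a\<^sup>2 + b\<^sup>2)"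
      "(b\<^sup>2 * \<mu> + a\<^sup>2 * \<nu>) * b + \<rho> * a = \<mu> * b * (a\<^sup>2 + b\<^sup>2)"
      "- ((a\<^sup>2 * \<mu> + b\<^sup>2 * \<nu>) * b) + \<rho> * a = - (\<nu> * b * (a\<^sup>2 + b\<^sup>2))"
      "(b\<^sup>2 * \<mu> + a\<^sup>2 * \<nu>) * a - \<rho> * b = \<nu> * a * (a\<^sup>2 + b\<^sup>2)"
      by (simp_all add: \<rho>_def power2_eq_square algebra_simps)
    note eqs = this[unfolded ab(3) mult_1_right]
    show "(\<Sum>j<N + 2 * p. C i j * h k j) = g k * h k i"
      using i
    proof (cases rule: nest_cases)
      case (inner i')
      have "(\<Sum>j<N + 2 * p. C i j * h k j)
         = c k * (\<Sum>j<N. A i' j * w (s k) j) + \<rho> * d k * w 0 i' * (\<Sum>j<2 * p. x 0 j * x (t k) j)"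
        unfolding C_def h_def inner(2) sum_nest_mult
        by (simp add: sum_distrib_left mult_ac)
      also have "\<dots> = c k * e (s k) * w (s k) i' + \<rho> * d k * of_bool (t k = 0) * w 0 i'"
        using k p inner by (simp add: Aw xx st)
      also have "\<dots> = g k * (c k * w (s k) i')"
        using arg_cong[OF eqs(1), of "\<lambda>r. r * w 0 i'"] arg_cong[OF eqs(3), of "\<lambda>r. r * w 0 i'"]
        by (auto simp: c_def d_def s_def t_def g_def A(5) algebra_simps)
      finally show ?thesis by (simp add: h_def inner(2))
    next
      case (outer i')
      have "(\<Sum>j<N + 2 * p. C i j * h k j)
         = \<rho> * c k * x 0 i' * (\<Sum>j<N. w 0 j * w (s k) j) + d k * (\<Sum>j<2 * p. B i' j * x (t k) j)"
        unfolding C_def h_def outer(2) sum_nest_mult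
        by (simp add: sum_distrib_left mult_ac)
      also have "\<dots> = \<rho> * c k * of_bool (s k = 0) * x 0 i' + d k * f (t k) * x (t k) i'"
        using k N0 outer by (simp add: Bx ww st)
      also have "\<dots> = g k * (d k * x (t k) i')"
        using arg_cong[OF eqs(2), of "\<lambda>r. r * x 0 i'"] arg_cong[OF eqs(4), of "\<lambda>r. r * x 0 i'"]
        by (auto simp: c_def d_def s_def t_def g_def B(5) algebra_simps)
      finally show ?thesis by (simp add: h_def outer(2))
    qed
  qed
  moreover have "h 0 i \<ge> 0 \<and> h 0 (N + 2 * p - 1 - i) = h 0 i" if "i < N + 2 * p" for i
    using that
  proof (cases rule: nest_cases)
    case (inner j)
    then show ?thesis unfolding h_def inner(2-)
      using ab N0 A(3) reflect by (simp add: c_def s_def)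
  next
    case (outer j)
    then show ?thesis unfolding h_def outer(2-)
      using ab N0 B(3) reflect by (simp add: d_def t_def)
  qed
  moreover have "g 0 = \<mu>" by (simp add: g_def)
  moreover have "mset (map g [1..<N + 2 * p]) = add_mset \<nu> (X + Y)"
  proof -
    have "[1..<N + 2 * p] = [1..<N] @ [N..<N + 2 * p]"
      using N0 upt_add_eq_append[of 1 N "2 * p"] by simp
    also have "[N..<N + 2 * p] = N # map (\<lambda>k. k + N) [1..<2 * p]"
      using p map_add_upt[of N "2 * p"] by (simp add: upt_conv_Cons[of 0] add.commute)
    finally have "map g [1..<N + 2 * p] = map e [1..<N] @ \<nu> # map f [1..<2 * p]"
      using N0 by (auto simp: g_def)
    then show ?thesis using A(6) B(6) by simp
  qed
  moreover have "Suc (size (add_mset \<nu> (X + Y))) = N + 2 * p"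
    using p N_def by simp
  ultimately show ?thesis
    unfolding realisable_def Let_def by (metis (no_types, lifting))
qed

section \<open>Uncoupled and coupled attachment of an even block\<close>

lemma realisable_direct_sum:
  assumes "realisable \<mu> X" "realisable \<nu> Y" "odd (size Y)"
  shows "realisable \<mu> (add_mset \<nu> (X + Y))"
  using realisable_nest[of 1 \<mu> 0 \<nu> X Y] assms by simp

text \<open>The 2 x 2 matrix with eigenvalues \<open>\<mu>\<close>, \<open>\<nu>\<close> can be
  rotated to have any diagonal entry \<open>\<beta>\<close> between them; the trace fixes the other
  diagonal entry.\<close>

lemma realisable_coupled:
  assumes "realisable (\<mu> + \<nu> - \<beta>) X" "realisable \<beta> Y" "odd (size Y)" "\<nu> \<le> \<beta>" "\<beta> \<le> \<mu>"
  shows "realisable \<mu> (add_mset \<nu> (X + Y))"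
proof (cases "\<nu> = \<mu>")
  case True
  with assms have "\<beta> = \<nu>" by simp
  with assms show ?thesis using realisable_direct_sum[of \<mu> X \<nu> Y] by simp
next
  case False
  then have pos: "\<mu> - \<nu> > 0" using assms by simp
  \<comment> \<open>Solves \<open>b\<^sup>2 * \<mu> + a\<^sup>2 * \<nu> = \<beta>\<close> together
    with \<open>a\<^sup>2 + b\<^sup>2 = 1\<close>.\<close>
  define a where "a = sqrt ((\<mu> - \<beta>) / (\<mu> - \<nu>))"
  define b where "b = sqrt ((\<beta> - \<nu>) / (\<mu> - \<nu>))"
  have a2: "a\<^sup>2 = (\<mu> - \<beta>) / (\<mu> - \<nu>)" and b2: "b\<^sup>2 = (\<beta> - \<nu>) / (\<mu> - \<nu>)"
    using assms pos by (simp_all add: a_def b_def)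
  have ab: "a \<ge> 0" "b \<ge> 0" using assms pos by (simp_all add: a_def b_def)
  have *: "a\<^sup>2 + b\<^sup>2 = 1" using pos by (simp add: a2 b2 flip: add_divide_distrib)
  have b3: "b\<^sup>2 * (\<mu> - \<nu>) = \<beta> - \<nu>" using pos by (simp add: b2)
  have a3: "a\<^sup>2 = 1 - b\<^sup>2" using * by simp
  have "b\<^sup>2 * \<mu> + a\<^sup>2 * \<nu> = \<beta>" "a\<^sup>2 * \<mu> + b\<^sup>2 * \<nu> = \<mu> + \<nu> - \<beta>"
    using b3 unfolding a3 by (simp_all add: algebra_simps)
  then show ?thesis
    using realisable_nest[of a \<mu> b \<nu> X Y] assms ab * pos by simp
qed

section \<open>Lists whose remaining entries have one sign\<close>

lemma multiset_cases_2:
  obtains "M = {#}" | x where "M = {#x#}" | x y M' where "M = add_mset x (add_mset y M')"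
  by (metis multiset_cases)

text \<open>Two entries are removed at a time: a block with eigenvalues \<open>- x\<close> and
  \<open>x\<close> is coupled so that \<open>- x\<close> becomes \<open>y\<close>. The core keeps
  \<open>\<mu> + x + y\<close>, so the total with the remaining entries is unchanged. Nonpositivity
  of these and of \<open>y\<close> gives \<open>- x \<le> \<mu>\<close>.\<close>

lemma realisable_nonpos:
  assumes "\<And>x. x \<in># X \<Longrightarrow> x \<le> 0" "\<mu> + \<Sum>\<^sub># X \<ge> 0"
  shows "realisable \<mu> X"
  using assms
proof (induction "size X" arbitrary: X \<mu> rule: less_induct)
  case less
  show ?case
  proof (cases X rule: multiset_cases_2)
    case 1
    then show ?thesis using less.prems realisable_empty by simp
  next
    case (2 x)
    then show ?thesis using less.prems realisable_single[of x \<mu>] by simp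
  next
    case (3 x y X')
    have nonpos: "x \<le> 0" "y \<le> 0" "\<And>z. z \<in># X' \<Longrightarrow> z \<le> 0" using less.prems(1) 3 by auto
    have "\<Sum>\<^sub># X' \<le> 0" using nonpos(3) by (induction X') (auto intro: add_nonpos_nonpos)
    moreover have "realisable (\<mu> + y - - x) X'"
      by (rule less.hyps) (use 3 nonpos less.prems(2) in auto)
    moreover have "realisable (- x) {#x#}" using nonpos by (intro realisable_single) simp
    ultimately have "realisable \<mu> (add_mset y (X' + {#x#}))"
      using nonpos less.prems(2) 3 by (intro realisable_coupled[where \<beta> = "- x"]) auto
    then show ?thesis using 3 by (simp add: add_mset_commute)
  qed
qed

text \<open>Pairs form uncoupled 2 x 2 blocks. A leftover entry shares a block with
  \<open>\<mu>\<close>, which is where the upper bound enters.\<close>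

lemma realisable_nonneg:
  assumes "\<mu> \<ge> 0" "\<And>x. x \<in># X \<Longrightarrow> 0 \<le> x \<and> x \<le> \<mu>"
  shows "realisable \<mu> X"
  using assms(2)
proof (induction "size X" arbitrary: X rule: less_induct)
  case less
  show ?case
  proof (cases X rule: multiset_cases_2)
    case 1
    then show ?thesis using assms realisable_empty by simp
  next
    case (2 x)
    then show ?thesis using less.prems realisable_single[of x \<mu>] by simp
  next
    case (3 x y X')
    have nonneg: "0 \<le> x" "0 \<le> y" using less.prems 3 by auto
    have *: "realisable \<mu> X'"
      by (rule less.hyps) (use 3 less.prems in auto)
    have "realisable (max x y) {#min x y#}" using nonneg by (intro realisable_single) simp
    from realisable_direct_sum[OF * this]
    have "realisable \<mu> (add_mset (max x y) (X' + {#min x y#}))" by simp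
    then show ?thesis using 3 by (simp add: add_mset_commute max_def min_def split: if_splits)
  qed
qed

section \<open>From functions to matrices and characteristic polynomials\<close>

lemma reverse_id_mult:
  assumes "i < N" "j < N" "A \<in> carrier_mat N N"
  shows "(reverse_id_mat N * A * reverse_id_mat N) $$ (i, j) = A $$ (N - 1 - i, N - 1 - j)"
proof -
  have J: "reverse_id_mat N \<in> carrier_mat N N" by (simp add: reverse_id_mat_def)
  have 1: "(reverse_id_mat N * A) $$ (i, j) = A $$ (N - 1 - i, j)" if "i < N" "j < N" for i j
  proof -
    have "(reverse_id_mat N * A) $$ (i, j) = (\<Sum>k<N. (if k = N - 1 - i then 1 else 0) * A $$ (k, j))"
      using that assms J
      by (auto simp: scalar_prod_def reverse_id_mat_def atLeast0LessThan intro!: sum.cong)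
    then show ?thesis using that by (simp add: if_distrib[of "\<lambda>c. c * _"] cong: if_cong)
  qed
  have "(reverse_id_mat N * A * reverse_id_mat N) $$ (i, j)
      = (\<Sum>k<N. (reverse_id_mat N * A) $$ (i, k) * (if k = N - 1 - j then 1 else 0))"
    using assms J
    by (auto simp: scalar_prod_def reverse_id_mat_def atLeast0LessThan intro!: sum.cong)
  then show ?thesis using 1 assms by (simp add: if_distrib[of "\<lambda>c. _ * c"] cong: if_cong)
qed

text \<open>The matrix \<open>W\<close> with the eigenvectors as columns is orthogonal, so
  \<open>Q\<close> is similar to the diagonal matrix \<open>D\<close>.\<close>

lemma realisable_imp_matrix:
  assumes "realisable \<mu> X"
  shows "\<exists>A \<in> carrier_mat (Suc (size X)) (Suc (size X)). nonneg_matrix A \<and> bisymmetric A \<and>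
    char_poly A = (\<Prod>x\<in>#add_mset \<mu> X. [:- x, 1:])"
proof -
  define N where "N = Suc (size X)"
  obtain A e w where A: "bisym_fun N A" "eigenbasis N A e w"
    "e 0 = \<mu>" "mset (map e [1..<N]) = X"
    using assms unfolding realisable_def Let_def N_def[symmetric] by blast
  define Q where "Q = mat N N (\<lambda>(i, j). A i j)"
  define W where "W = mat N N (\<lambda>(i, k). w k i)"
  define D where "D = mat N N (\<lambda>(i, j). if i = j then e i else 0)"
  have car: "Q \<in> carrier_mat N N" "W \<in> carrier_mat N N" "D \<in> carrier_mat N N"
      "transpose_mat W \<in> carrier_mat N N" "reverse_id_mat N \<in> carrier_mat N N"
    by (simp_all add: Q_def W_def D_def reverse_id_mat_def)
  have nonneg: "nonneg_matrix Q"
    using A(1) by (auto simp: nonneg_matrix_def bisym_fun_def Q_def)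
  have sym: "transpose_mat Q = Q"
    by (rule eq_matI) (use A(1) in \<open>auto simp: bisym_fun_def Q_def\<close>)
  have "reverse_id_mat N * Q * reverse_id_mat N = Q"
  proof (rule eq_matI)
    fix i j assume "i < dim_row Q" "j < dim_col Q"
    then have "i < N" "j < N" using car by auto
    then show "(reverse_id_mat N * Q * reverse_id_mat N) $$ (i, j) = Q $$ (i, j)"
      using reverse_id_mult[OF _ _ car(1)] A(1) by (simp add: bisym_fun_def Q_def)
  qed (use car in auto)
  with sym have bisym: "bisymmetric Q"
    unfolding bisymmetric_def using car by (auto simp: square_mat.simps)
  have WW: "transpose_mat W * W = 1\<^sub>m N"
    by (rule eq_matI)
      (use A(2) in \<open>auto simp: W_def scalar_prod_def atLeast0LessThan eigenbasis_def\<close>)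
  then have WW': "W * transpose_mat W = 1\<^sub>m N"
    using mat_mult_left_right_inverse[OF car(4,2)] by simp
  have "Q * W = W * D"
  proof (rule eq_matI)
    fix i k assume "i < dim_row (W * D)" "k < dim_col (W * D)"
    then have ik: "i < N" "k < N" using car by auto
    then have "(Q * W) $$ (i, k) = e k * w k i"
      using A(2) by (simp add: Q_def W_def scalar_prod_def atLeast0LessThan eigenbasis_def)
    also have "\<dots> = (W * D) $$ (i, k)"
      using ik by (simp add: D_def W_def scalar_prod_def if_distrib mult_ac cong: if_cong)
    finally show "(Q * W) $$ (i, k) = (W * D) $$ (i, k)" .
  qed (use car in auto)
  then have "Q = W * D * transpose_mat W"
    using car WW' by (metis assoc_mult_mat right_mult_one_mat)
  then have "similar_mat Q D"
    using car WW WW' by (intro similar_matI[of _ D W "transpose_mat W" N]) auto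
  then have "char_poly Q = char_poly D" by (rule char_poly_similar)
  also have "\<dots> = (\<Prod>a\<leftarrow>diag_mat D. [:- a, 1:])"
    by (rule char_poly_upper_triangular[OF car(3)]) (auto simp: D_def upper_triangular_def)
  also have "diag_mat D = map e [0..<N]"
    by (simp add: diag_mat_def D_def)
  also have "[0..<N] = 0 # [1..<N]"
    by (simp add: N_def upt_conv_Cons del: upt_Suc)
  also have "(\<Prod>a\<leftarrow>map e (0 # [1..<N]). [:- a, 1:]) = (\<Prod>x\<in>#mset (map e (0 # [1..<N])). [:- x, 1:])"
    by (metis mset_map prod_mset_prod_list)
  also have "mset (map e (0 # [1..<N])) = add_mset \<mu> X"
    using A(3,4) by simp
  finally show ?thesis
    using nonneg bisym car(1) unfolding N_def by blast
qed

section \<open>Iterated wrapping and the final assembly\<close>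

text \<open>Blocks are attached from \<open>m\<close> down to 1, so block 1 is outermost;
  \<open>\<mu> k\<close> is the distinguished eigenvalue that the core and blocks \<open>k\<close>
  to \<open>m\<close> must supply together.\<close>

lemma realisable_chain:
  fixes \<mu>\<^sub>0 :: real and a :: "nat \<Rightarrow> real" and Y :: "nat \<Rightarrow> real multiset"
  defines "\<mu> \<equiv> \<lambda>k. \<mu>\<^sub>0 + (\<Sum>i\<in>{1..<k}. min 0 (a i + \<Sum>\<^sub># (Y i)))"
  assumes core: "realisable (\<mu> (Suc m)) X"
    and Y: "\<And>i x. i \<in> {1..m} \<Longrightarrow> x \<in># Y i \<Longrightarrow> x \<le> 0" "\<And>i. i \<in> {1..m} \<Longrightarrow> odd (size (Y i))"
    and bound: "\<And>k. k \<in> {1..m} \<Longrightarrow> a k + \<Sum>\<^sub># (Y k) < 0 \<Longrightarrow> \<mu> k + \<Sum>\<^sub># (Y k) \<ge> 0"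
  shows "realisable \<mu>\<^sub>0 (X + (\<Sum>i\<in>{1..m}. add_mset (a i) (Y i)))"
proof -
  have "realisable (\<mu> k) (X + (\<Sum>i\<in>{k..m}. add_mset (a i) (Y i)))" if "1 \<le> k" "k \<le> Suc m" for k
    using that(2,1)
  proof (induction k rule: inc_induct)
    case base
    then show ?case using core by simp
  next
    case (step k)
    let ?X = "X + (\<Sum>i\<in>{Suc k..m}. add_mset (a i) (Y i))"
    have k: "k \<in> {1..m}" using step by simp
    have IH: "realisable (\<mu> (Suc k)) ?X" using step by simp
    have \<mu>: "\<mu> (Suc k) = \<mu> k + min 0 (a k + \<Sum>\<^sub># (Y k))"
      using k by (simp add: \<mu>_def)
    have "realisable (\<mu> k) (add_mset (a k) (?X + Y k))"
    \<comment> \<open>In deficit, \<open>a k\<close> is too small to carry \<open>Y k\<close>, so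
      the block uses the least eigenvalue with nonnegative trace and borrows the difference from the
      core by coupling.\<close>
    proof (cases "a k + \<Sum>\<^sub># (Y k) < 0")
      case True
      have "realisable (- \<Sum>\<^sub># (Y k)) (Y k)"
        using Y k by (intro realisable_nonpos) auto
      then show ?thesis
        using IH \<mu> True bound[OF k True] Y(2)[OF k]
        by (intro realisable_coupled[where \<beta> = "- \<Sum>\<^sub># (Y k)"]) (auto simp: add.assoc)
    next
      case False
      have "realisable (a k) (Y k)"
        using Y k False by (intro realisable_nonpos) auto
      then show ?thesis
        using IH \<mu> False Y(2)[OF k] by (intro realisable_direct_sum) auto
    qed
    moreover have "{k..m} = insert k {Suc k..m}" using k by auto
    ultimately show ?case by (simp add: add_ac)
  qed
  from this[of 1] show ?thesis by (simp add: \<mu>_def)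
qed

lemma image_mset_set_UN:
  assumes "finite I" "\<And>i. i \<in> I \<Longrightarrow> finite (A i)" "disjoint_family_on A I"
  shows "image_mset f (mset_set (\<Union>i\<in>I. A i)) = (\<Sum>i\<in>I. image_mset f (mset_set (A i)))"
  using assms
proof (induction I rule: finite_induct)
  case (insert i I)
  then have "A i \<inter> (\<Union>j\<in>I. A j) = {}"
    by (fastforce simp: disjoint_family_on_def)
  moreover have "disjoint_family_on A I"
    using insert.prems(2) by (auto simp: disjoint_family_on_def)
  ultimately show ?case using insert by (simp add: mset_set_Union)
qed simp

theorem theorem3p6:
  fixes M n S :: nat
    and lam T :: "nat \<Rightarrow> real"
    and \<Lambda> :: "nat \<Rightarrow> nat set"
    and K :: "nat set"
  defines "T \<equiv> block_sum lam \<Lambda>"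
    and "K \<equiv> deficit_indices lam T M S"
  assumes "M \<le> n"
    and "\<And>i j. i \<le> j \<Longrightarrow> j \<le> n \<Longrightarrow> lam i \<ge> lam j"
    and "\<And>i. i \<le> M \<Longrightarrow> lam i \<ge> 0"
    and "\<And>i. M < i \<Longrightarrow> i \<le> n \<Longrightarrow> lam i < 0"
    and "indexed_partition {M+1..n} S \<Lambda>"
    and "\<And>j. j \<in> {1..min M S} \<Longrightarrow> odd (card (\<Lambda> j))"
    and "\<And>i j. 1 \<le> i \<Longrightarrow> i \<le> j \<Longrightarrow> j \<le> S \<Longrightarrow> T j \<ge> T i"
    and "\<And>k. k \<in> K \<Longrightarrow> lam 0 + (\<Sum>i\<in>{i \<in> K. i < k}. lam i + T i) + T k \<ge> 0"
    and "lam 0 + (\<Sum>i\<in>K. lam i + T i) + (\<Sum>j=M+1..S. T j) \<ge> 0"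
  shows "\<exists>A \<in> carrier_mat (n+1) (n+1). nonneg_matrix A \<and> bisymmetric A \<and>
           char_poly A = (\<Prod>i\<le>n. [:- lam i, 1:])"
proof -
  define m where "m = min M S"
  define Y where "Y i = image_mset lam (mset_set (\<Lambda> i))" for i
  define \<mu> where "\<mu> k = lam 0 + (\<Sum>i\<in>{1..<k}. min 0 (lam i + \<Sum>\<^sub># (Y i)))" for k
  note part = assms(7)[unfolded indexed_partition_def]
  have UN: "(\<Union>i\<in>{1..S}. \<Lambda> i) = {M+1..n}"
    using part by (auto simp: partition_on_def)
  have disj: "disjoint_family_on \<Lambda> {1..S}"
    using part unfolding partition_on_def disjoint_family_on_def disjoint_def
    by (metis image_eqI inj_onD)
  have sub: "\<Lambda> i \<subseteq> {M+1..n}" if "i \<in> {1..S}" for i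
    using UN that by blast
  have fin: "finite (\<Lambda> i)" if "i \<in> {1..S}" for i
    using sub[OF that] finite_subset by blast
  have sumY: "\<Sum>\<^sub># (Y i) = T i" for i
    by (simp add: Y_def T_def block_sum_def sum_unfold_sum_mset)
  have Yneg: "x \<le> 0" if i: "i \<in> {1..S}" and x: "x \<in># Y i" for i x
  proof -
    obtain j where "j \<in> \<Lambda> i" "x = lam j"
      using x fin[OF i] by (auto simp: Y_def)
    with sub[OF i] assms(6)[of j] show ?thesis by auto
  qed
  have K: "K = {i \<in> {1..m}. lam i + T i < 0}"
    by (simp add: K_def deficit_indices_def m_def)
  have \<mu>_eq: "\<mu> k = lam 0 + (\<Sum>i\<in>{i \<in> K. i < k}. lam i + T i)" if "k \<le> Suc m" for k
  proof -
    have "(\<Sum>i\<in>{i \<in> K. i < k}. lam i + T i) = (\<Sum>i\<in>{1..<k}. min 0 (lam i + \<Sum>\<^sub># (Y i)))"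
      using that by (intro sum.mono_neutral_cong_left) (auto simp: K sumY)
    then show ?thesis by (simp add: \<mu>_def)
  qed
  have "{i \<in> K. i < Suc m} = K" by (auto simp: K)
  then have \<mu>_end: "\<mu> (Suc m) = lam 0 + (\<Sum>i\<in>K. lam i + T i)"
    using \<mu>_eq[of "Suc m"] by simp
  \<comment> \<open>At most one summand is nonempty: the first needs \<open>S < M\<close>, the
    second \<open>M < S\<close>.\<close>
  define X where "X = image_mset lam (mset_set {m+1..M}) + (\<Sum>i\<in>{m+1..S}. Y i)"
  have "realisable (\<mu> (Suc m)) X"
  proof (cases "S \<le> M")
    case True
    then have X: "X = image_mset lam (mset_set {m+1..M})" by (simp add: X_def m_def)
    have pos: "\<mu> (Suc m) \<ge> 0" using assms(11) True by (simp add: \<mu>_end)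
    have le: "lam j \<le> \<mu> (Suc m)" if j: "j \<in> {m+1..M}" for j
    proof (cases "K = {}")
      case True
      then show ?thesis using assms(3) assms(4)[of 0 j] j by (simp add: \<mu>_end)
    next
      case False
      \<comment> \<open>At the last deficit index, condition (1) says exactly that the core
        eigenvalue is at least \<open>lam k\<close>; surplus indices come after
        \<open>k\<close>.\<close>
      define k where "k = Max K"
      have finK: "finite K" by (simp add: K)
      have k: "k \<in> K" using False finK by (simp add: k_def)
      have "i \<le> k" if "i \<in> K" for i
        using that finK by (simp add: k_def)
      then have "K = insert k {i \<in> K. i < k}" using k by (auto simp: order_le_less)
      then have "(\<Sum>i\<in>K. lam i + T i) = (\<Sum>i\<in>insert k {i \<in> K. i < k}. lam i + T i)" by simp
      also have "\<dots> = lam k + T k + (\<Sum>i\<in>{i \<in> K. i < k}. lam i + T i)"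
        using finK by simp
      finally have "lam k \<le> \<mu> (Suc m)" using assms(10)[OF k] by (simp add: \<mu>_end)
      moreover have "lam j \<le> lam k" using k j assms(3) by (intro assms(4)) (auto simp: K)
      ultimately show ?thesis by simp
    qed
    show ?thesis unfolding X
      using pos le assms(5) by (intro realisable_nonneg) auto
  next
    case False
    then have m: "m = M" and X: "X = (\<Sum>i\<in>{M+1..S}. Y i)" by (simp_all add: X_def m_def)
    \<comment> \<open>With this total, (2) becomes the trace condition for a nonpositive
      list.\<close>
    have "\<Sum>\<^sub># X = (\<Sum>i\<in>{M+1..S}. T i)"
      unfolding X by (induction rule: infinite_finite_induct) (simp_all add: sumY)
    moreover have "x \<le> 0" if "x \<in># X" for x
    proof -
      have "\<exists>i\<in>{M+1..S}. x \<in># Y i" using that unfolding X by (simp add: set_mset_sum)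
      then obtain i where "i \<in> {M+1..S}" "x \<in># Y i" by blast
      then show ?thesis using Yneg[of i x] by simp
    qed
    ultimately show ?thesis
      using assms(11) by (intro realisable_nonpos) (auto simp: \<mu>_end)
  qed
  moreover have "x \<le> 0" if "i \<in> {1..m}" "x \<in># Y i" for i x
    using Yneg[of i x] that by (simp add: m_def)
  moreover have "odd (size (Y i))" if "i \<in> {1..m}" for i
    using assms(8)[of i] that by (simp add: Y_def m_def)
  moreover have "\<mu> k + \<Sum>\<^sub># (Y k) \<ge> 0" if "k \<in> {1..m}" "lam k + \<Sum>\<^sub># (Y k) < 0" for k
    using that assms(10)[of k] \<mu>_eq[of k] by (simp add: K sumY)
  ultimately have "realisable (lam 0) (X + (\<Sum>i\<in>{1..m}. add_mset (lam i) (Y i)))"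
    unfolding \<mu>_def by (rule realisable_chain[where a = lam and Y = Y and m = m])
  also have "X + (\<Sum>i\<in>{1..m}. add_mset (lam i) (Y i)) = image_mset lam (mset_set {1..n})"
  proof -
    have "(\<Sum>i\<in>{1..m}. add_mset (lam i) (Y i)) = (\<Sum>i\<in>{1..m}. {#lam i#} + Y i)" by simp
    also have "\<dots> = (\<Sum>i\<in>{1..m}. {#lam i#}) + (\<Sum>i\<in>{1..m}. Y i)" by (rule sum.distrib)
    also have "(\<Sum>i\<in>{1..m}. {#lam i#}) = image_mset lam (mset_set {1..m})"
      using image_mset_set_UN[of "{1..m}" "\<lambda>i. {i}" lam] by (simp add: disjoint_family_on_def)
    finally have "X + (\<Sum>i\<in>{1..m}. add_mset (lam i) (Y i))
      = image_mset lam (mset_set {1..m} + mset_set {m+1..M}) + ((\<Sum>i\<in>{1..m}. Y i) + (\<Sum>i\<in>{m+1..S}. Y i))"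
      by (simp add: X_def add_ac)
    also have "mset_set {1..m} + mset_set {m+1..M} = mset_set ({1..m} \<union> {m+1..M})"
      by (rule mset_set_Union[symmetric]) auto
    also have "{1..m} \<union> {m+1..M} = {1..M}" by (auto simp: m_def)
    also have "(\<Sum>i\<in>{1..m}. Y i) + (\<Sum>i\<in>{m+1..S}. Y i) = (\<Sum>i\<in>{1..m} \<union> {m+1..S}. Y i)"
      by (rule sum.union_disjoint[symmetric]) auto
    also have "{1..m} \<union> {m+1..S} = {1..S}" by (auto simp: m_def)
    also have "(\<Sum>i\<in>{1..S}. Y i) = image_mset lam (mset_set {M+1..n})"
      using image_mset_set_UN[OF _ fin disj, of lam] UN by (simp add: Y_def)
    also have "image_mset lam (mset_set {1..M}) + image_mset lam (mset_set {M+1..n})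
      = image_mset lam (mset_set ({1..M} \<union> {M+1..n}))"
      by (subst mset_set_Union) auto
    also have "{1..M} \<union> {M+1..n} = {1..n}" using assms(3) by auto
    finally show ?thesis .
  qed
  finally have "realisable (lam 0) (image_mset lam (mset_set {1..n}))" .
  moreover have "(\<Prod>x\<in>#add_mset (lam 0) (image_mset lam (mset_set {1..n})). [:- x, 1:]) = (\<Prod>i\<le>n. [:- lam i, 1:])"
  proof -
    have "{..n} = insert 0 {1..n}" by auto
    then show ?thesis by (simp add: prod_unfold_prod_mset image_mset.compositionality o_def)
  qed
  ultimately show ?thesis
    using realisable_imp_matrix[of "lam 0" "image_mset lam (mset_set {1..n})"] by simp
qed

end
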